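(* Let $r\geq 2$ and $n\geq r^3+r^2-r$ be integers where $r$ divides $n$, and suppose $H$ is an $n$-vertex $r$-graph with $\delta_{r-1}^+(H) \geq \left(\frac{r-1}{r}\right) n+r^2$ and $d_1(v) > 0$ for every $v \in V(H)$. Then $H$ contains a perfect matching.
   Context: An $r$-graph $H=(V,E)$ is an $r$-uniform hypergraph: $V=V(H)$ is a finite vertex set and $E=E(H) \subseteq \binom{V}{r}$ is a set of $r$-element subsets of $V$, called edges. For a vertex $v$, $d_1(v)$ is the number of edges of $H$ containing $v$. For an $(r-1)$-element set $S\subseteq V(H)$, its co-degree $d_{r-1}(S)$ is the number of edges of $H$ containing $S$. The minimum positive co-degree $\delta_{r-1}^+(H)$ is the largest integer $k$ such that for every $S \in \binom{V}{r-1}$ either $d_{r-1}(S)=0$ or $d_{r-1}(S)\ge k$; if $H$ has no edges, $\delta_{r-1}^+(H)=0$. A matching in $H$ is a set of pairwise disjoint edges of $H$; it is perfect if every vertex of $H$ lies in (exactly) one of its edges. *)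

theory Defs
  imports Complex_Main
begin

definition r_graph :: "nat \<Rightarrow> 'a set \<Rightarrow> 'a set set \<Rightarrow> bool" where
  "r_graph r V E \<longleftrightarrow> finite V \<and> (\<forall>e\<in>E. e \<subseteq> V \<and> card e = r)"

definition vertex_degree :: "'a set set \<Rightarrow> 'a \<Rightarrow> nat" where
  "vertex_degree E v = card {e \<in> E. v \<in> e}"

definition co_degree :: "'a set set \<Rightarrow> 'a set \<Rightarrow> nat" where
  "co_degree E S = card {e \<in> E. S \<subseteq> e}"

text \<open>In an r-graph (with \<open>r \<ge> 1\<close>) that has an edge, some \<open>(r - 1)\<close>-set of vertices has
  positive co-degree, so the admissible values of \<open>k\<close> below are bounded and the greatest one exists.
  Without edges every \<open>k\<close> is admissible, and the value is fixed to be 0.\<close>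

definition min_pos_co_degree :: "nat \<Rightarrow> 'a set \<Rightarrow> 'a set set \<Rightarrow> nat" where
  "min_pos_co_degree r V E =
    (if E = {} then 0
     else (GREATEST k. \<forall>S. S \<subseteq> V \<and> card S = r - 1 \<longrightarrow>
                          co_degree E S = 0 \<or> k \<le> co_degree E S))"

definition matching :: "'a set set \<Rightarrow> 'a set set \<Rightarrow> bool" where
  "matching E M \<longleftrightarrow> M \<subseteq> E \<and> pairwise disjnt M"

definition perfect_matching :: "'a set \<Rightarrow> 'a set set \<Rightarrow> 'a set set \<Rightarrow> bool" where
  "perfect_matching V E M \<longleftrightarrow> matching E M \<and> (\<forall>v\<in>V. \<exists>!e. e \<in> M \<and> v \<in> e)"

end

theory Submission
  imports Defs
begin

text \<open>
  Call an \<open>(r - 1)\<close>-set that lies in some edge a shadow set. The co-degree condition says that a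
  shadow set \<open>S\<close> has at most \<open>n / r - r\<^sup>2\<close> vertices \<open>z\<close> for which \<open>insert z S\<close> is not an edge. The
  proof shows that a maximum matching \<open>M\<close> covers everything, by trading edges of \<open>M\<close> for shadow sets
  and turning shadow sets back into edges at a profit.

  The profitable direction (\<open>exchange\<close>): a matching \<open>N\<close> together with \<open>t\<close> disjoint shadow sets
  outside it, covering fewer than \<open>r\<^sup>3\<close> vertices, yields a matching with \<open>t - \<lceil>t / r\<rceil>\<close> more edges. If
  a shadow set has a neighbour outside \<open>N\<close> and outside all the shadow sets, it becomes an edge for
  free. Otherwise each shadow set \<open>S\<close> already misses all the remaining free vertices, so few of its
  non-neighbours are left for \<open>N\<close>: fewer than one per edge of \<open>N\<close> on average. Taking \<open>s \<le> r\<close> of the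
  shadow sets, some edge \<open>e\<close> of \<open>N\<close> sees fewer than \<open>s\<close> missing pairs, which is so few that the \<open>s\<close>
  sets can be completed to edges by distinct vertices of \<open>e\<close>. This gives up one edge and creates \<open>s\<close>.

  To start (\<open>augment\<close>), suppose that \<open>M\<close> misses a vertex. As \<open>r\<close> divides \<open>n\<close> it misses a set \<open>U\<close>
  of \<open>r\<close> vertices. Through each vertex of \<open>U\<close> a shadow set can be grown, swapping one vertex at a time
  inside an edge, so that these \<open>r\<close> sets are disjoint and their union meets each edge of \<open>M\<close> at most
  once. At most \<open>j \<le> r (r - 2)\<close> edges of \<open>M\<close> are hit. Removing them costs \<open>j\<close> edges, but each hit
  edge loses a single vertex to the new sets, so its remainder is again a shadow set. There are now
  \<open>r + j \<le> r (r - 1)\<close> shadow sets, and the exchange recovers at least \<open>r + j - (r - 1) = j + 1\<close>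
  edges, so \<open>M\<close> was not maximum.
\<close>

section \<open>Distinct representatives when few pairs are missing\<close>

text \<open>A Hall-type statement with a quantitative hypothesis that is stable under deletion: choosing
  the representative of an element \<open>a\<close> that has a missing pair removes at least one missing pair
  together with one element of \<open>A\<close>, so the hypothesis is inherited. If nothing is missing,
  any choice works.\<close>

lemma distinct_representatives:
  assumes "finite A" "finite B" "card A \<le> card B"
    and "(\<Sum>a\<in>A. card (B - G a)) < card A"
  shows "\<exists>f. inj_on f A \<and> (\<forall>a\<in>A. f a \<in> B \<inter> G a)"
  using assms
proof (induction "card A" arbitrary: A B)
  case 0
  then show ?case by simp
next
  case (Suc m A B)
  obtain a where a: "a \<in> A" "B - G a \<noteq> {} \<or> (\<forall>x\<in>A. B - G x = {})"
    using Suc.hyps(2) by (metis card.empty nat.distinct(1) ex_in_conv)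
  have split: "(\<Sum>x\<in>A. card (B - G x)) = card (B - G a) + (\<Sum>x\<in>A - {a}. card (B - G x))"
    using a(1) Suc.prems(1) by (simp add: sum.remove)
  have "card (B - G a) < card B"
    using split Suc.prems(3,4) by linarith
  then obtain b where b: "b \<in> B" "b \<in> G a"
    by (metis Diff_iff less_irrefl subsetI card_mono finite_Diff Suc.prems(2) not_le)
  have cA: "card (A - {a}) = m" and cB: "card (B - {b}) = card B - 1"
    using Suc.hyps(2) Suc.prems(1,2) a(1) b(1) by simp_all
  show ?case
  proof (cases "m = 0")
    case True
    then have "A = {a}"
      using cA a(1) Suc.prems(1) by (metis card_0_eq finite_Diff insert_Diff)
    with b show ?thesis
      by (intro exI[of _ "\<lambda>_. b"]) auto
  next
    case False
    have le: "(\<Sum>x\<in>A - {a}. card (B - {b} - G x)) \<le> (\<Sum>x\<in>A - {a}. card (B - G x))"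
      by (rule sum_mono, rule card_mono) (use Suc.prems(2) in auto)
    have "(\<Sum>x\<in>A - {a}. card (B - G x)) < m"
    proof (cases "B - G a = {}")
      case True
      with a(2) have all: "\<forall>x\<in>A. B - G x = {}"
        by blast
      have "(\<Sum>x\<in>A - {a}. card (B - G x)) = 0"
        by (rule sum.neutral) (metis all DiffD1 card.empty)
      with \<open>m \<noteq> 0\<close> show ?thesis by linarith
    next
      case False
      then have "card (B - G a) > 0"
        using Suc.prems(2) by (simp add: card_gt_0_iff)
      with split Suc.prems(4) Suc.hyps(2) show ?thesis by linarith
    qed
    with le have "(\<Sum>x\<in>A - {a}. card (B - {b} - G x)) < card (A - {a})"
      using cA by linarith
    moreover have "card (A - {a}) \<le> card (B - {b})"
      using cA cB Suc.hyps(2) Suc.prems(3) by linarith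
    ultimately obtain f where f: "inj_on f (A - {a})" "\<forall>x\<in>A - {a}. f x \<in> (B - {b}) \<inter> G x"
      using Suc.hyps(1)[of "A - {a}" "B - {b}"] cA Suc.prems(1,2) by auto
    have "inj_on (f(a := b)) A"
      using f by (auto simp: inj_on_def)
    moreover have "\<forall>x\<in>A. (f(a := b)) x \<in> B \<inter> G x"
      using f b by auto
    ultimately show ?thesis by blast
  qed
qed

section \<open>Exchanges along shadow sets\<close>

text \<open>The last assumption is the co-degree condition in the form in which it is used: it bounds the
  non-neighbours of a shadow set by \<open>n / r - r\<^sup>2\<close>, multiplied by \<open>r\<close> to stay within the natural
  numbers.\<close>

locale dense_shadow =
  fixes r :: nat and V :: "'a set" and E :: "'a set set"
  assumes r_ge_2: "r \<ge> 2"
    and finite_V: "finite V"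
    and edge_subset: "e \<in> E \<Longrightarrow> e \<subseteq> V"
    and edge_card: "e \<in> E \<Longrightarrow> card e = r"
    and few_non_neighbours:
      "card S = r - 1 \<Longrightarrow> e \<in> E \<Longrightarrow> S \<subseteq> e \<Longrightarrow>
        r * card (V - {z. insert z S \<in> E}) + r ^ 3 \<le> card V"
begin

definition shadow :: "'a set \<Rightarrow> bool" where
  "shadow S \<longleftrightarrow> card S = r - 1 \<and> (\<exists>e\<in>E. S \<subseteq> e)"

definition nbhd :: "'a set \<Rightarrow> 'a set" where
  "nbhd S = {z. insert z S \<in> E}"

lemma shadow_card: "shadow S \<Longrightarrow> card S = r - 1"
  by (simp add: shadow_def)

lemma shadow_subset: "shadow S \<Longrightarrow> S \<subseteq> V"
  using edge_subset by (auto simp: shadow_def)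

lemma shadow_finite: "shadow S \<Longrightarrow> finite S"
  using shadow_subset finite_V finite_subset by blast

lemma shadow_nonempty: "shadow S \<Longrightarrow> S \<noteq> {}"
  using shadow_card[of S] r_ge_2 by auto

lemma nbhd_subset: "nbhd S \<subseteq> V"
  using edge_subset by (auto simp: nbhd_def)

lemma shadow_non_neighbours:
  assumes "shadow S"
  shows "r * card (V - nbhd S) + r ^ 3 \<le> card V"
  using assms few_non_neighbours unfolding shadow_def nbhd_def by blast

text \<open>With \<open>m\<close> non-neighbours there are \<open>n - m \<ge> n - r m \<ge> r\<^sup>3\<close> neighbours. This crude bound is what
  leaves room to avoid a bounded number of blocked vertices.\<close>

lemma shadow_neighbours:
  assumes "shadow S"
  shows "r ^ 3 \<le> card (nbhd S)"
proof -
  have "card (V - nbhd S) \<le> r * card (V - nbhd S)"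
    using r_ge_2 by simp
  moreover have "card V = card (V - nbhd S) + card (nbhd S)"
    using nbhd_subset finite_V
    by (metis card_Diff_subset card_mono finite_subset le_add_diff_inverse2)
  ultimately show ?thesis
    using shadow_non_neighbours[OF assms] by linarith
qed

lemma finite_E: "finite E"
  using edge_subset finite_V by (meson Pow_iff finite_Pow_iff finite_subset subsetI)

lemma edge_finite: "e \<in> E \<Longrightarrow> finite e"
  using edge_subset finite_V finite_subset by blast

lemma matching_finite: "matching E N \<Longrightarrow> finite N"
  using finite_E finite_subset by (auto simp: matching_def)

lemma matching_disjoint: "matching E N \<Longrightarrow> e \<in> N \<Longrightarrow> f \<in> N \<Longrightarrow> e \<noteq> f \<Longrightarrow> e \<inter> f = {}"
  by (simp add: matching_def pairwise_def disjnt_def)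

lemma matching_subset: "matching E N \<Longrightarrow> \<Union>N \<subseteq> V"
  using edge_subset by (auto simp: matching_def)

lemma matching_cover_card:
  assumes "matching E N"
  shows "card (\<Union>N) = r * card N"
proof -
  have "card (\<Union>N) = (\<Sum>e\<in>N. card e)"
    using assms edge_finite by (intro card_Union_disjoint) (auto simp: matching_def)
  also have "\<dots> = (\<Sum>e\<in>N. r)"
    using assms edge_card by (intro sum.cong) (auto simp: matching_def)
  finally show ?thesis by simp
qed

lemma shadow_family_card:
  assumes "pairwise disjnt \<S>" "\<And>S. S \<in> \<S> \<Longrightarrow> shadow S"
  shows "card (\<Union>\<S>) = (r - 1) * card \<S>"
proof -
  have "card (\<Union>\<S>) = (\<Sum>S\<in>\<S>. card S)"
    using assms shadow_finite by (intro card_Union_disjoint) auto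
  also have "\<dots> = (\<Sum>S\<in>\<S>. r - 1)"
    using assms shadow_card by (intro sum.cong) auto
  finally show ?thesis by simp
qed

text \<open>If \<open>S\<close> has no neighbour in the set \<open>R\<close> of vertices outside \<open>N\<close> and \<open>\<S>\<close>, then \<open>R\<close> uses up \<open>|R|\<close> of its at
  most \<open>n / r - r\<^sup>2\<close> non-neighbours, while
  \<open>n / r = |N| + (|\<Union>\<S>| + |R|) / r < |N| + r\<^sup>2 + |R|\<close>. So fewer than \<open>|N|\<close> non-neighbours lie in the
  matching.\<close>

lemma missing_in_matching:
  assumes N: "matching E N"
    and fam: "pairwise disjnt \<S>" "\<And>S. S \<in> \<S> \<Longrightarrow> shadow S"
    and disj: "\<Union>\<S> \<inter> \<Union>N = {}"
    and small: "card (\<Union>\<S>) < r ^ 3"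
    and S: "S \<in> \<S>" "nbhd S \<subseteq> \<Union>N \<union> \<Union>\<S>"
  shows "card (\<Union>N - nbhd S) < card N"
proof -
  define R where "R = V - (\<Union>N \<union> \<Union>\<S>)"
  have sub: "\<Union>N \<subseteq> V" "\<Union>\<S> \<subseteq> V"
    using matching_subset[OF N] fam(2) shadow_subset by blast+
  then have fin: "finite (\<Union>N)" "finite (\<Union>\<S>)" "finite R"
    using finite_V finite_subset unfolding R_def by (blast, blast, blast)
  have "card V = card (\<Union>N) + card (\<Union>\<S>) + card R"
  proof -
    have "V = (\<Union>N \<union> \<Union>\<S>) \<union> R"
      using sub R_def by auto
    then have "card V = card (\<Union>N \<union> \<Union>\<S>) + card R"
      using fin by (metis R_def Diff_disjoint card_Un_disjoint finite_UnI)
    also have "card (\<Union>N \<union> \<Union>\<S>) = card (\<Union>N) + card (\<Union>\<S>)"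
      using fin disj by (intro card_Un_disjoint) auto
    finally show ?thesis .
  qed
  then have V: "card V = r * card N + card (\<Union>\<S>) + card R"
    using matching_cover_card[OF N] by simp
  have "card ((\<Union>N - nbhd S) \<union> R) \<le> card (V - nbhd S)"
    using sub S(2) finite_V by (intro card_mono) (auto simp: R_def)
  also have "card ((\<Union>N - nbhd S) \<union> R) = card (\<Union>N - nbhd S) + card R"
    using fin by (intro card_Un_disjoint) (auto simp: R_def)
  finally have "r * (card (\<Union>N - nbhd S) + card R) \<le> r * card (V - nbhd S)"
    by simp
  then have "r * card (\<Union>N - nbhd S) + r * card R + r ^ 3 \<le> card V"
    using shadow_non_neighbours[OF fam(2)[OF S(1)]] by (simp add: algebra_simps)
  moreover have "card R \<le> r * card R"
    using r_ge_2 by simp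
  ultimately have "r * card (\<Union>N - nbhd S) < r * card N"
    using V small by linarith
  then show ?thesis by simp
qed

text \<open>Double counting: the missing pairs between \<open>\<T>\<close> and the edges of \<open>N\<close> number fewer than
  \<open>|\<T>| |N|\<close>.\<close>

lemma exchange_edge:
  assumes N: "matching E N"
    and \<T>: "finite \<T>" "\<T> \<noteq> {}"
    and missing: "\<And>S. S \<in> \<T> \<Longrightarrow> card (\<Union>N - nbhd S) < card N"
  shows "\<exists>e\<in>N. (\<Sum>S\<in>\<T>. card (e - nbhd S)) < card \<T>"
proof (rule ccontr)
  assume "\<not> ?thesis"
  then have "(\<Sum>e\<in>N. card \<T>) \<le> (\<Sum>e\<in>N. \<Sum>S\<in>\<T>. card (e - nbhd S))"
    by (intro sum_mono) (simp add: not_less)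
  also have "\<dots> = (\<Sum>S\<in>\<T>. \<Sum>e\<in>N. card (e - nbhd S))"
    by (rule sum.swap)
  also have "\<dots> = (\<Sum>S\<in>\<T>. card (\<Union>N - nbhd S))"
  proof (intro sum.cong refl)
    fix S
    have "card (\<Union>e\<in>N. e - nbhd S) = (\<Sum>e\<in>N. card (e - nbhd S))"
    proof (rule card_UN_disjoint)
      show "finite N"
        by (rule matching_finite[OF N])
      show "\<forall>e\<in>N. finite (e - nbhd S)"
        using N edge_finite by (auto simp: matching_def)
      show "\<forall>e\<in>N. \<forall>f\<in>N. e \<noteq> f \<longrightarrow> (e - nbhd S) \<inter> (f - nbhd S) = {}"
        using N by (auto simp: matching_def pairwise_def disjnt_def)
    qed
    moreover have "(\<Union>e\<in>N. e - nbhd S) = \<Union>N - nbhd S"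
      by auto
    ultimately show "(\<Sum>e\<in>N. card (e - nbhd S)) = card (\<Union>N - nbhd S)"
      by simp
  qed
  also have "\<dots> < (\<Sum>S\<in>\<T>. card N)"
    using \<T> missing by (intro sum_strict_mono)
  finally show False
    by (simp add: mult.commute)
qed

text \<open>Both moves of the exchange are instances: \<open>K = {}\<close> completes a single shadow set by a free
  vertex, and \<open>K = {e}\<close> completes several by distinct vertices of the removed edge \<open>e\<close>.\<close>

lemma replace_edges:
  assumes N: "matching E N" and K: "K \<subseteq> N"
    and \<T>: "finite \<T>" "pairwise disjnt \<T>" "\<And>S. S \<in> \<T> \<Longrightarrow> shadow S" "\<Union>\<T> \<inter> \<Union>N = {}"
    and f: "inj_on f \<T>" "\<And>S. S \<in> \<T> \<Longrightarrow> f S \<in> nbhd S"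
      "\<And>S. S \<in> \<T> \<Longrightarrow> f S \<notin> \<Union>(N - K)" "\<And>S. S \<in> \<T> \<Longrightarrow> f S \<notin> \<Union>\<T>"
  defines "N' \<equiv> (N - K) \<union> (\<lambda>S. insert (f S) S) ` \<T>"
  shows "matching E N'" and "card N' + card K = card N + card \<T>"
proof -
  let ?g = "\<lambda>S. insert (f S) S"
  have new_disjnt: "disjnt (?g S) (?g T)" if "S \<in> \<T>" "T \<in> \<T>" "S \<noteq> T" for S T
  proof -
    have "S \<inter> T = {}"
      using \<T>(2) that by (simp add: pairwise_def disjnt_def)
    moreover have "f S \<noteq> f T"
      using f(1) that by (auto simp: inj_on_def)
    moreover have "f S \<notin> T" "f T \<notin> S"
      using f(4) that by blast+
    ultimately show ?thesis
      by (auto simp: disjnt_def)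
  qed
  have old_disjnt: "disjnt e (?g S)" if "e \<in> N - K" "S \<in> \<T>" for e S
    using f(3)[OF that(2)] that \<T>(4) by (auto simp: disjnt_def)
  have "N' \<subseteq> E"
    using N f(2) by (auto simp: N'_def matching_def nbhd_def)
  moreover have "pairwise disjnt N'"
    unfolding pairwise_def
  proof (intro ballI impI)
    fix x y
    assume xy: "x \<in> N'" "y \<in> N'" "x \<noteq> y"
    show "disjnt x y"
    proof (cases "x \<in> N - K")
      case x: True
      show ?thesis
      proof (cases "y \<in> N - K")
        case True
        with x xy(3) N show ?thesis
          by (auto simp: matching_def pairwise_def)
      next
        case False
        with xy(2) x show ?thesis
          using old_disjnt by (auto simp: N'_def)
      qed
    next
      case False
      with xy(1) obtain S where S: "S \<in> \<T>" "x = ?g S"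
        by (auto simp: N'_def)
      show ?thesis
      proof (cases "y \<in> N - K")
        case True
        with S show ?thesis
          using old_disjnt disjnt_sym by blast
      next
        case False
        with xy(2) obtain T where "T \<in> \<T>" "y = ?g T"
          by (auto simp: N'_def)
        with S xy(3) show ?thesis
          using new_disjnt by blast
      qed
    qed
  qed
  ultimately show "matching E N'"
    by (simp add: matching_def)
  have "inj_on ?g \<T>"
  proof (rule inj_onI, rule ccontr)
    fix S T
    assume "S \<in> \<T>" "T \<in> \<T>" "?g S = ?g T" "S \<noteq> T"
    then show False
      using new_disjnt[of S T] by (auto simp: disjnt_def)
  qed
  then have "card (?g ` \<T>) = card \<T>"
    by (rule card_image)
  moreover have "(N - K) \<inter> ?g ` \<T> = {}"
  proof (rule ccontr)
    assume "(N - K) \<inter> ?g ` \<T> \<noteq> {}"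
    then obtain S where "S \<in> \<T>" "?g S \<in> N - K"
      by blast
    then show False
      using old_disjnt[of "?g S" S] by (auto simp: disjnt_def)
  qed
  moreover have finN: "finite N"
    by (rule matching_finite[OF N])
  ultimately have "card N' = card (N - K) + card \<T>"
    unfolding N'_def using \<T>(1) by (simp add: card_Un_disjoint)
  moreover have "card (N - K) + card K = card N"
    using finN K by (metis card_Diff_subset card_mono finite_subset le_add_diff_inverse2)
  ultimately show "card N' + card K = card N + card \<T>"
    by simp
qed

text \<open>Each move that removes an edge of \<open>N\<close> consumes \<open>r\<close> shadow sets, or all of them if fewer are
  left. Hence at most \<open>q\<close> such moves happen, and each of the \<open>|\<S>|\<close> shadow sets becomes an edge. The
  free moves only help; they do not touch \<open>q\<close>. Using an incomplete batch at the end matters: without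
  it the gain would fall short in \<open>augment\<close>. New edges may be removed again by later moves, so nothing
  besides \<open>\<S>\<close> and \<open>N\<close> has to be tracked.\<close>

lemma exchange:
  assumes "matching E N"
    and "finite \<S>" "pairwise disjnt \<S>" "\<And>S. S \<in> \<S> \<Longrightarrow> shadow S"
    and "\<Union>\<S> \<inter> \<Union>N = {}"
    and "card (\<Union>\<S>) < r ^ 3"
    and "card \<S> \<le> q * r"
  shows "\<exists>N'. matching E N' \<and> card N + card \<S> \<le> card N' + q"
  using assms
proof (induction "card \<S>" arbitrary: \<S> N q rule: less_induct)
  case less
  note IH = less.hyps and N = less.prems(1) and fin = less.prems(2) and pd = less.prems(3)
    and sh = less.prems(4) and disj = less.prems(5) and small = less.prems(6)
    and q = less.prems(7)
  have finU: "finite (\<Union>\<S>)"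
    using fin sh shadow_finite by auto
  have rest: "finite (\<S> - \<T>)" "pairwise disjnt (\<S> - \<T>)" "card (\<Union>(\<S> - \<T>)) < r ^ 3"
      "\<Union>\<T> \<inter> \<Union>(\<S> - \<T>) = {}" if "\<T> \<subseteq> \<S>" for \<T>
  proof -
    show "finite (\<S> - \<T>)"
      using fin by simp
    show "pairwise disjnt (\<S> - \<T>)"
      using pd by (rule pairwise_subset) auto
    have "card (\<Union>(\<S> - \<T>)) \<le> card (\<Union>\<S>)"
      using finU by (intro card_mono) auto
    with small show "card (\<Union>(\<S> - \<T>)) < r ^ 3"
      by linarith
    have "S \<inter> T = {}" if "S \<in> \<T>" "T \<in> \<S> - \<T>" for S T
    proof -
      have "S \<in> \<S>" "T \<in> \<S>" "S \<noteq> T"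
        using \<open>\<T> \<subseteq> \<S>\<close> that by auto
      then show ?thesis
        using pd by (simp add: pairwise_def disjnt_def)
    qed
    then show "\<Union>\<T> \<inter> \<Union>(\<S> - \<T>) = {}"
      by blast
  qed
  show ?case
  proof (cases "\<S> = {}")
    case True
    with N show ?thesis by auto
  next
    case nonempty: False
    show ?thesis
    proof (cases "\<exists>S\<in>\<S>. \<not> nbhd S \<subseteq> \<Union>N \<union> \<Union>\<S>")
      case True
      then obtain S z where S: "S \<in> \<S>" "z \<in> nbhd S" "z \<notin> \<Union>N" "z \<notin> \<Union>\<S>"
        by blast
      define N1 where "N1 = (N - {}) \<union> (\<lambda>S. insert z S) ` {S}"
      have N1: "matching E N1" "card N1 + card ({} :: 'a set set) = card N + card {S}"
        unfolding N1_def using S sh disj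
        by (intro replace_edges[OF N]; auto)+
      have S1: "{S} \<subseteq> \<S>"
        using S(1) by simp
      have less: "card (\<S> - {S}) < card \<S>"
        using fin S(1) by (rule card_Diff1_less)
      have "\<Union>(\<S> - {S}) \<inter> \<Union>N1 = {}"
        using rest(4)[of "{S}"] S disj by (auto simp: N1_def)
      moreover have "card (\<S> - {S}) \<le> q * r"
        using less q by linarith
      ultimately obtain N' where "matching E N'" "card N1 + card (\<S> - {S}) \<le> card N' + q"
        using IH[OF less N1(1) rest(1,2)[OF S1] _ _ rest(3)[OF S1], of q] sh by blast
      moreover have "card N1 + card (\<S> - {S}) = card N + card \<S>"
        using N1(2) fin S(1) card_gt_0_iff[of \<S>] by (auto simp: card_Diff_singleton)
      ultimately show ?thesis by auto
    next
      case False
      then have closed: "\<And>S. S \<in> \<S> \<Longrightarrow> nbhd S \<subseteq> \<Union>N \<union> \<Union>\<S>"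
        by blast
      have "card \<S> > 0"
        using fin nonempty by (simp add: card_gt_0_iff)
      with q obtain p where p: "q = Suc p"
        by (cases q) auto
      obtain \<T> where \<T>: "\<T> \<subseteq> \<S>" "card \<T> = min r (card \<S>)" "finite \<T>"
        by (meson obtain_subset_with_card_n min.cobounded2)
      have T_pos: "card \<T> > 0"
        using \<T>(2) \<open>card \<S> > 0\<close> r_ge_2 by simp
      then have "\<T> \<noteq> {}"
        by auto
      moreover have "\<And>S. S \<in> \<T> \<Longrightarrow> card (\<Union>N - nbhd S) < card N"
        using missing_in_matching[OF N pd sh disj small] closed \<T>(1) by blast
      ultimately obtain e where e: "e \<in> N" "(\<Sum>S\<in>\<T>. card (e - nbhd S)) < card \<T>"
        using exchange_edge[OF N \<T>(3)] by blast
      have eE: "e \<in> E"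
        using e(1) N by (auto simp: matching_def)
      have "card \<T> \<le> card e"
        using \<T>(2) edge_card[OF eE] by simp
      then obtain f where f: "inj_on f \<T>" "\<forall>S\<in>\<T>. f S \<in> e \<inter> nbhd S"
        using distinct_representatives[OF \<T>(3) edge_finite[OF eE] _ e(2)] by blast
      have f_old: "f S \<notin> \<Union>(N - {e})" if "S \<in> \<T>" for S
      proof
        assume "f S \<in> \<Union>(N - {e})"
        then obtain e' where "e' \<in> N" "e' \<noteq> e" "f S \<in> e'"
          by blast
        with matching_disjoint[OF N] e(1) have "e' \<inter> e = {}"
          by blast
        with \<open>f S \<in> e'\<close> f(2) that show False
          by blast
      qed
      have f_\<S>: "f S \<notin> \<Union>\<S>" if "S \<in> \<T>" for S
        using f(2) that e(1) disj by blast
      define N1 where "N1 = (N - {e}) \<union> (\<lambda>S. insert (f S) S) ` \<T>"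
      have pdT: "pairwise disjnt \<T>"
        using pd \<T>(1) by (rule pairwise_subset)
      have shT: "\<And>S. S \<in> \<T> \<Longrightarrow> shadow S"
        using sh \<T>(1) by blast
      have disjT: "\<Union>\<T> \<inter> \<Union>N = {}"
        using disj \<T>(1) by blast
      have fT: "\<And>S. S \<in> \<T> \<Longrightarrow> f S \<in> nbhd S" "\<And>S. S \<in> \<T> \<Longrightarrow> f S \<notin> \<Union>\<T>"
        using f(2) f_\<S> \<T>(1) by blast+
      have K: "{e} \<subseteq> N"
        using e(1) by simp
      have N1: "matching E N1" "card N1 + card {e} = card N + card \<T>"
        unfolding N1_def
        using replace_edges[OF N K \<T>(3) pdT shT disjT f(1) fT(1) f_old fT(2)] by blast+
      have cdiff: "card (\<S> - \<T>) + card \<T> = card \<S>"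
        using \<T>(1,3) fin by (metis card_Diff_subset card_mono le_add_diff_inverse2)
      then have less: "card (\<S> - \<T>) < card \<S>"
        using T_pos by linarith
      have "\<Union>(\<S> - \<T>) \<inter> \<Union>N1 = {}"
      proof -
        have "\<Union>N1 \<subseteq> \<Union>N \<union> \<Union>\<T> \<union> f ` \<T>"
          by (auto simp: N1_def)
        moreover have "\<Union>(\<S> - \<T>) \<inter> f ` \<T> = {}"
          using f_\<S> by blast
        ultimately show ?thesis
          using rest(4)[OF \<T>(1)] disj by blast
      qed
      moreover have "card (\<S> - \<T>) \<le> p * r"
        using cdiff \<T>(2) q p by (cases "r \<le> card \<S>") auto
      ultimately obtain N' where "matching E N'" "card N1 + card (\<S> - \<T>) \<le> card N' + p"
        using IH[OF less N1(1) rest(1,2)[OF \<T>(1)] _ _ rest(3)[OF \<T>(1)], of p] sh by blast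
      moreover have "card N1 + card (\<S> - \<T>) + 1 = card N + card \<S>"
        using N1(2) cdiff by simp
      ultimately show ?thesis
        using p by auto
    qed
  qed
qed

section \<open>Shadow sets through prescribed vertices\<close>

definition partial_transversal :: "'a set set \<Rightarrow> 'a set \<Rightarrow> bool" where
  "partial_transversal M X \<longleftrightarrow> (\<forall>f\<in>M. \<forall>x\<in>f \<inter> X. \<forall>y\<in>f \<inter> X. x = y)"

text \<open>Every vertex of \<open>X\<close> blocks itself and the edge of \<open>M\<close> through it, at most \<open>r\<close> vertices in
  all.\<close>

lemma partial_transversal_insert:
  assumes M: "matching E M" and X: "finite X" "partial_transversal M X" and A: "r * card X < card A"
  shows "\<exists>z\<in>A. z \<notin> X \<and> partial_transversal M (insert z X)"
proof -
  define B where "B x = insert x (\<Union>{f\<in>M. x \<in> f})" for x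
  have B_card: "finite (B x) \<and> card (B x) \<le> r" for x
  proof (cases "\<exists>f\<in>M. x \<in> f")
    case True
    then obtain f where f: "f \<in> M" "x \<in> f"
      by blast
    then have "{f\<in>M. x \<in> f} = {f}"
      using M by (auto simp: matching_def pairwise_def disjnt_def)
    then have "B x = f"
      using f by (auto simp: B_def)
    then show ?thesis
      using f M edge_card edge_finite by (auto simp: matching_def)
  next
    case False
    then have "B x = {x}"
      by (auto simp: B_def)
    then show ?thesis
      using r_ge_2 by simp
  qed
  have "card (\<Union>x\<in>X. B x) \<le> (\<Sum>x\<in>X. card (B x))"
    using X(1) by (rule card_UN_le)
  also have "\<dots> \<le> (\<Sum>x\<in>X. r)"
    using B_card by (intro sum_mono) simp
  also have "\<dots> < card A"
    using A by (simp add: mult.commute)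
  finally have "\<not> A \<subseteq> (\<Union>x\<in>X. B x)"
    using card_mono[of "\<Union>x\<in>X. B x" A] X(1) B_card by auto
  then obtain z where z: "z \<in> A" "z \<notin> (\<Union>x\<in>X. B x)"
    by blast
  then have "z \<notin> X" and "\<forall>f\<in>M. z \<in> f \<longrightarrow> f \<inter> X = {}"
    by (auto simp: B_def)
  then have "partial_transversal M (insert z X)"
    using X(2) unfolding partial_transversal_def by blast
  with z(1) \<open>z \<notin> X\<close> show ?thesis
    by blast
qed

text \<open>Starting from any edge through \<open>u\<close>, the vertices other than \<open>u\<close> are swapped one at a time for
  suitable new ones: dropping a vertex \<open>x\<close> that has not been swapped yet leaves a shadow set, whose at
  least \<open>r\<^sup>3\<close> neighbours outnumber the at most \<open>r \<cdot> |X \<union> T|\<close> blocked vertices.\<close>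

lemma grow_shadow:
  assumes M: "matching E M" and X: "finite X" "partial_transversal M X"
    and u: "u \<in> X" "e \<in> E" "u \<in> e"
    and k: "k < r" "card X + k \<le> r * (r - 1)"
  shows "\<exists>T e. finite T \<and> card T = k \<and> T \<inter> X = {} \<and> partial_transversal M (X \<union> T) \<and>
    e \<in> E \<and> insert u T \<subseteq> e"
  using k
proof (induction k)
  case 0
  then show ?case
    using X u by (intro exI[of _ "{}"] exI[of _ e]) auto
next
  case (Suc k)
  then obtain T e where T: "finite T" "card T = k" "T \<inter> X = {}" "partial_transversal M (X \<union> T)"
    and e: "e \<in> E" "insert u T \<subseteq> e"
    by (meson Suc_leD Suc_lessD add_Suc_right le_trans lessI less_imp_le add_le_mono order_refl)
  have "card (insert u T) < card e"
    using T u(1) edge_card[OF e(1)] Suc.prems(1) by (auto simp: card_insert_if)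
  then have "insert u T \<noteq> e"
    by auto
  then obtain x where x: "x \<in> e" "x \<notin> insert u T"
    using e(2) by blast
  have sh: "shadow (e - {x})"
    using e(1) x(1) edge_card[OF e(1)] by (auto simp: shadow_def)
  have "card (X \<union> T) = card X + k"
    using X(1) T by (simp add: card_Un_disjoint inf_commute)
  then have "card (X \<union> T) < r * r"
    using Suc.prems(2) r_ge_2 by (simp add: diff_mult_distrib2)
  then have "r * card (X \<union> T) < r ^ 3"
    using r_ge_2 by (simp add: power3_eq_cube)
  then have "r * card (X \<union> T) < card (nbhd (e - {x}))"
    using shadow_neighbours[OF sh] by linarith
  then obtain z where z: "z \<in> nbhd (e - {x})" "z \<notin> X \<union> T" "partial_transversal M (insert z (X \<union> T))"
    using partial_transversal_insert[OF M _ T(4)] X(1) T(1) by blast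
  show ?case
  proof (intro exI conjI)
    show "finite (insert z T)" "card (insert z T) = Suc k" "insert z T \<inter> X = {}"
      using T z(2) by auto
    show "partial_transversal M (X \<union> insert z T)"
      using z(3) by simp
    show "insert z (e - {x}) \<in> E"
      using z(1) by (simp add: nbhd_def)
    show "insert u (insert z T) \<subseteq> insert z (e - {x})"
      using e(2) x(2) by auto
  qed
qed

text \<open>The shadow sets are grown one after the other. Keeping all of \<open>U\<close>, and not only \<open>W\<close>, inside
  the partial transversal stops earlier sets from using vertices of \<open>U\<close> that are reserved for later
  ones.\<close>

lemma shadow_family_through:
  assumes M: "matching E M" and U: "finite U" "card U = r" "U \<inter> \<Union>M = {}"
    and cover: "U \<subseteq> \<Union>E" and W: "W \<subseteq> U"
  shows "\<exists>\<S>. finite \<S> \<and> card \<S> = card W \<and> pairwise disjnt \<S> \<and> (\<forall>S\<in>\<S>. shadow S) \<and>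
    \<Union>\<S> \<inter> U = W \<and> partial_transversal M (U \<union> \<Union>\<S>)"
  using finite_subset[OF W U(1)] W
proof (induction W rule: finite_induct)
  case empty
  show ?case
    using U(3) by (intro exI[of _ "{}"]) (auto simp: partial_transversal_def)
next
  case (insert u W)
  then obtain \<S> where \<S>: "finite \<S>" "card \<S> = card W" "pairwise disjnt \<S>" "\<And>S. S \<in> \<S> \<Longrightarrow> shadow S"
      "\<Union>\<S> \<inter> U = W" "partial_transversal M (U \<union> \<Union>\<S>)"
    by blast
  have finX: "finite (\<Union>\<S>)"
    using \<S>(1,4) shadow_finite by auto
  have "Suc (card W) \<le> r"
    using insert.hyps insert.prems U(1,2) by (metis card_insert_disjoint card_mono)
  \<comment> \<open>The union has \<open>r\<close> vertices in \<open>U\<close> and \<open>r - 2\<close> more for each finished set.\<close>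
  have "card (U \<union> \<Union>\<S>) + (r - 2) \<le> r * (r - 1)"
  proof -
    have "card (U \<union> \<Union>\<S>) + card (\<Union>\<S> \<inter> U) = r + (r - 1) * card W"
      using card_Un_Int[OF U(1) finX] shadow_family_card[OF \<S>(3,4)] U(2) \<S>(2)
      by (simp add: inf_commute)
    then have "card (U \<union> \<Union>\<S>) + card W = r + (r - 1) * card W"
      using \<S>(5) by simp
    moreover obtain s where s: "r = s + 2"
      using r_ge_2 by (metis add.commute le_Suc_ex)
    ultimately have "card (U \<union> \<Union>\<S>) + (r - 2) = s + 2 + s * (card W + 1)"
      by (simp add: algebra_simps)
    also have "\<dots> \<le> s + 2 + s * (s + 2)"
      using \<open>Suc (card W) \<le> r\<close> s by (intro add_left_mono mult_left_mono) simp_all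
    also have "\<dots> = r * (r - 1)"
      using s by (simp add: algebra_simps)
    finally show ?thesis .
  qed
  moreover obtain e where "e \<in> E" "u \<in> e"
    using insert.prems cover by blast
  ultimately obtain T e where T: "finite T" "card T = r - 2" "T \<inter> (U \<union> \<Union>\<S>) = {}"
      "partial_transversal M (U \<union> \<Union>\<S> \<union> T)" and e: "e \<in> E" "insert u T \<subseteq> e"
    using grow_shadow[OF M _ \<S>(6), of u e "r - 2"] U(1) finX insert.prems r_ge_2 by auto
  have uT: "u \<notin> T"
    using T(3) insert.prems by blast
  have sh: "shadow (insert u T)"
    using T(1,2) uT e r_ge_2 by (auto simp: shadow_def)
  have new: "disjnt (insert u T) S" if "S \<in> \<S>" for S
    using T(3) \<S>(5) insert.hyps insert.prems that by (auto simp: disjnt_def)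
  then have "insert u T \<notin> \<S>"
    by auto
  show ?case
  proof (intro exI conjI)
    show "finite (insert (insert u T) \<S>)"
      using \<S>(1) by simp
    show "card (insert (insert u T) \<S>) = card (insert u W)"
      using \<S>(1,2) \<open>insert u T \<notin> \<S>\<close> insert.hyps by simp
    show "pairwise disjnt (insert (insert u T) \<S>)"
      using \<S>(3) new by (auto simp: pairwise_insert disjnt_sym)
    show "\<forall>S\<in>insert (insert u T) \<S>. shadow S"
      using sh \<S>(4) by blast
    show "\<Union>(insert (insert u T) \<S>) \<inter> U = insert u W"
      using \<S>(5) T(3) insert.prems by auto
    have "U \<union> \<Union>(insert (insert u T) \<S>) = U \<union> \<Union>\<S> \<union> T"
      using insert.prems by auto
    then show "partial_transversal M (U \<union> \<Union>(insert (insert u T) \<S>))"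
      using T(4) by simp
  qed
qed

section \<open>Augmenting a matching\<close>

text \<open>Of the \<open>r (r - 1)\<close> vertices of the new shadow sets, \<open>r\<close> are in \<open>U\<close>, so at most \<open>r (r - 2)\<close>
  edges of \<open>M\<close> are hit. This is exactly the number for which the new sets and the remainders of the
  hit edges can be exchanged with \<open>q = r - 1\<close>, for a net gain of one edge.\<close>

lemma augment:
  assumes M: "matching E M" and U: "card U = r" "U \<subseteq> V" "U \<inter> \<Union>M = {}"
    and cover: "U \<subseteq> \<Union>E"
  shows "\<exists>N. matching E N \<and> card M < card N"
proof -
  have finU: "finite U"
    using U(2) finite_V finite_subset by blast
  obtain \<S> where \<S>: "finite \<S>" "card \<S> = r" "pairwise disjnt \<S>" "\<And>S. S \<in> \<S> \<Longrightarrow> shadow S"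
      "\<Union>\<S> \<inter> U = U" and trans: "partial_transversal M (U \<union> \<Union>\<S>)"
    using shadow_family_through[OF M finU U(1,3) cover subset_refl] U(1) by auto
  define X where "X = \<Union>\<S>"
  have finX: "finite X"
    using \<S>(1,4) shadow_finite by (auto simp: X_def)
  have UX: "U \<subseteq> X"
    using \<S>(5) by (auto simp: X_def)
  have transX: "partial_transversal M X"
    using trans UX by (simp add: X_def Un_absorb1)
  have cX: "card X = (r - 1) * r"
    using shadow_family_card[OF \<S>(3,4)] \<S>(2) by (simp add: X_def)
  define H where "H = {f \<in> M. f \<inter> X \<noteq> {}}"
  define \<H> where "\<H> = (\<lambda>f. f - X) ` H"
  have finM: "finite M"
    by (rule matching_finite[OF M])
  have HM: "H \<subseteq> M" and finH: "finite H"
    using finM by (auto simp: H_def)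
  have one: "card (f \<inter> X) = 1" if f: "f \<in> H" for f
  proof -
    obtain x where "x \<in> f \<inter> X"
      using f by (auto simp: H_def)
    then have "f \<inter> X = {x}"
      using transX f by (auto simp: partial_transversal_def H_def)
    then show ?thesis by simp
  qed
  have Hcard: "card H \<le> r * (r - 2)"
  proof -
    have "card (\<Union>f\<in>H. f \<inter> X) = (\<Sum>f\<in>H. card (f \<inter> X))"
      using finH finX M by (intro card_UN_disjoint)
        (auto simp: H_def matching_def pairwise_def disjnt_def)
    then have "card (\<Union>f\<in>H. f \<inter> X) = card H"
      using one by simp
    moreover have "card (\<Union>f\<in>H. f \<inter> X) \<le> card (X - U)"
      using finX U(3) HM by (intro card_mono) auto
    moreover have "card (X - U) = (r - 1) * r - r"
      using card_Diff_subset[OF finU UX] cX U(1) by simp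
    ultimately show ?thesis
      by (simp add: algebra_simps diff_mult_distrib2)
  qed
  have sh\<H>: "shadow S" if "S \<in> \<H>" for S
  proof -
    obtain f where f: "f \<in> H" "S = f - X"
      using \<open>S \<in> \<H>\<close> by (auto simp: \<H>_def)
    have fE: "f \<in> E"
      using f HM M by (auto simp: matching_def)
    have "card (f - X) = r - 1"
      using card_Diff_subset_Int[of f X] edge_finite[OF fE] edge_card[OF fE] one[OF f(1)] by simp
    then show ?thesis
      using fE f by (auto simp: shadow_def)
  qed
  have disj\<H>: "disjnt (f - X) (g - X)" if "f \<in> H" "g \<in> H" "f \<noteq> g" for f g
    using matching_disjoint[OF M _ _ that(3)] that(1,2) HM by (auto simp: disjnt_def)
  have c\<H>: "card \<H> = card H"
    unfolding \<H>_def
  proof (rule card_image, rule inj_onI, rule ccontr)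
    fix f g
    assume "f \<in> H" "g \<in> H" "f - X = g - X" "f \<noteq> g"
    moreover from this have "f - X \<noteq> {}"
      using sh\<H> shadow_nonempty by (auto simp: \<H>_def)
    ultimately show False
      using disj\<H>[of f g] by (auto simp: disjnt_def)
  qed
  have cross: "disjnt S T" if "S \<in> \<S>" "T \<in> \<H>" for S T
    using that by (auto simp: \<H>_def X_def disjnt_def)
  define \<F> where "\<F> = \<S> \<union> \<H>"
  have fin\<F>: "finite \<F>"
    using \<S>(1) finH by (simp add: \<F>_def \<H>_def)
  have sh\<F>: "\<And>S. S \<in> \<F> \<Longrightarrow> shadow S"
    using \<S>(4) sh\<H> by (auto simp: \<F>_def)
  have "\<S> \<inter> \<H> = {}"
  proof (rule ccontr)
    assume "\<S> \<inter> \<H> \<noteq> {}"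
    then obtain S where "S \<in> \<S>" "S \<in> \<H>"
      by blast
    then show False
      using cross[of S S] shadow_nonempty[OF sh\<H>[of S]] by (simp add: disjnt_def)
  qed
  then have c\<F>: "card \<F> = r + card H"
    using \<S>(1,2) finH c\<H> by (simp add: \<F>_def \<H>_def card_Un_disjoint)
  have pd\<F>: "pairwise disjnt \<F>"
  proof -
    have "pairwise disjnt \<H>"
      using disj\<H> by (auto simp: pairwise_def \<H>_def)
    with \<S>(3) cross show ?thesis
      unfolding \<F>_def pairwise_def using disjnt_sym by (metis Un_iff)
  qed
  have N: "matching E (M - H)"
    using M by (auto simp: matching_def intro: pairwise_subset)
  have "\<Union>\<H> \<inter> \<Union>(M - H) = {}"
  proof -
    have "f \<inter> g = {}" if "f \<in> H" "g \<in> M - H" for f g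
    proof -
      have "f \<in> M" "g \<in> M" "f \<noteq> g"
        using that HM by auto
      then show ?thesis
        by (rule matching_disjoint[OF M])
    qed
    then show ?thesis
      by (auto simp: \<H>_def)
  qed
  moreover have "X \<inter> \<Union>(M - H) = {}"
    by (auto simp: H_def)
  ultimately have disj: "\<Union>\<F> \<inter> \<Union>(M - H) = {}"
    by (auto simp: \<F>_def X_def)
  have size: "card \<F> \<le> (r - 1) * r"
  proof -
    have "r + r * (r - 2) = (r - 1) * r"
      using r_ge_2 by (metis Suc_diff_le Suc_1 diff_Suc_Suc minus_nat.diff_0 mult.commute mult_Suc_right
          One_nat_def diff_Suc_1 numeral_2_eq_2)
    then show ?thesis
      using c\<F> Hcard by linarith
  qed
  have small: "card (\<Union>\<F>) < r ^ 3"
  proof -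
    have "card (\<Union>\<F>) \<le> (r - 1) * ((r - 1) * r)"
      using shadow_family_card[OF pd\<F> sh\<F>] size by simp
    also have "\<dots> \<le> (r - 1) * (r * r)"
      by simp
    also have "\<dots> < r * (r * r)"
      using r_ge_2 by simp
    finally show ?thesis
      by (simp add: power3_eq_cube)
  qed
  obtain N' where N': "matching E N'" "card (M - H) + card \<F> \<le> card N' + (r - 1)"
    using exchange[OF N fin\<F> pd\<F> sh\<F> disj small size] by blast
  have "card (M - H) + card H = card M"
    using HM finM by (metis card_Diff_subset card_mono finH le_add_diff_inverse2)
  then have "card M < card N'"
    using N'(2) c\<F> r_ge_2 by linarith
  with N'(1) show ?thesis
    by blast
qed

lemma perfect_matching_exists:
  assumes dvd: "r dvd card V" and cover: "V \<subseteq> \<Union>E"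
  shows "\<exists>M. perfect_matching V E M"
proof -
  have "\<exists>M. matching E M \<and> (\<forall>N. matching E N \<longrightarrow> card N \<le> card M)"
  proof (rule ex_has_greatest_nat)
    show "matching E {}"
      by (simp add: matching_def)
    show "\<forall>N. matching E N \<longrightarrow> card N < Suc (card E)"
      using finite_E by (auto simp: matching_def less_Suc_eq_le intro: card_mono)
  qed
  then obtain M where M: "matching E M" and max: "\<And>N. matching E N \<Longrightarrow> card N \<le> card M"
    by blast
  have "V \<subseteq> \<Union>M"
  proof (rule ccontr)
    assume "\<not> V \<subseteq> \<Union>M"
    then have "card (V - \<Union>M) > 0"
      using finite_V by (auto simp: card_gt_0_iff)
    moreover have "r dvd card (V - \<Union>M)"
    proof -
      have "card (V - \<Union>M) = card V - r * card M"
        using matching_subset[OF M] finite_V matching_cover_card[OF M]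
        by (metis card_Diff_subset finite_subset)
      then show ?thesis
        using dvd by (simp add: dvd_diff_nat)
    qed
    ultimately have "r \<le> card (V - \<Union>M)"
      by (simp add: dvd_imp_le)
    then obtain U where "card U = r" "U \<subseteq> V - \<Union>M"
      by (meson obtain_subset_with_card_n)
    then obtain N where "matching E N" "card M < card N"
      using augment[OF M, of U] cover by blast
    with max show False
      using leD by blast
  qed
  moreover have "e = f" if "e \<in> M" "f \<in> M" "v \<in> e" "v \<in> f" for e f v
    using M that unfolding matching_def pairwise_def disjnt_def by blast
  ultimately have "\<forall>v\<in>V. \<exists>!e. e \<in> M \<and> v \<in> e"
    by (metis UnionE subsetD)
  with M show ?thesis
    unfolding perfect_matching_def by blast
qed

end

section \<open>From the minimum positive co-degree to few non-neighbours\<close>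

text \<open>The greatest admissible value is itself admissible, because the co-degree of \<open>S\<close> bounds all
  admissible values.\<close>

lemma min_pos_co_degree_le:
  assumes "r_graph r V E" "S \<subseteq> V" "card S = r - 1" "co_degree E S > 0"
  shows "min_pos_co_degree r V E \<le> co_degree E S"
proof -
  let ?P = "\<lambda>k. \<forall>S. S \<subseteq> V \<and> card S = r - 1 \<longrightarrow> co_degree E S = 0 \<or> k \<le> co_degree E S"
  have "?P (GREATEST k. ?P k)"
  proof (rule GreatestI_nat)
    show "?P 0"
      by simp
    show "k \<le> co_degree E S" if "?P k" for k
      using that assms by auto
  qed
  moreover have "E \<noteq> {}"
    using assms(4) by (auto simp: co_degree_def)
  ultimately show ?thesis
    using assms by (auto simp: min_pos_co_degree_def)
qed

lemma co_degree_eq_card_neighbours: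
  assumes "r \<ge> 1" "r_graph r V E" "card S = r - 1" "finite S"
  shows "co_degree E S = card {z. insert z S \<in> E}"
proof -
  have "(\<lambda>z. insert z S) ` {z. insert z S \<in> E} = {e \<in> E. S \<subseteq> e}"
  proof (intro equalityI subsetI)
    fix e
    assume e: "e \<in> {e \<in> E. S \<subseteq> e}"
    then have "card e = r" "finite e"
      using assms(1,2) by (auto simp: r_graph_def intro: finite_subset)
    then have "card (e - S) = 1"
      using e assms by (simp add: card_Diff_subset)
    then obtain z where "e - S = {z}"
      by (auto simp: card_1_singleton_iff)
    with e have "e = insert z S"
      by auto
    with e show "e \<in> (\<lambda>z. insert z S) ` {z. insert z S \<in> E}"
      by auto
  qed auto
  moreover have "inj_on (\<lambda>z. insert z S) {z. insert z S \<in> E}"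
  proof (rule inj_onI)
    fix y z
    assume y: "y \<in> {z. insert z S \<in> E}" and "insert y S = insert z S"
    have "y \<notin> S"
    proof
      assume "y \<in> S"
      with y have "card S = r"
        using assms(2) by (auto simp: r_graph_def insert_absorb)
      with assms(1,3) show False by simp
    qed
    with \<open>insert y S = insert z S\<close> show "y = z"
      by blast
  qed
  ultimately show ?thesis
    by (metis card_image co_degree_def)
qed

text \<open>Multiplying the co-degree bound by \<open>r\<close> gives \<open>(r - 1) n + r\<^sup>3 \<le> r d\<close> for the number \<open>d\<close> of
  neighbours of a shadow set, which is \<open>r (n - d) + r\<^sup>3 \<le> n\<close>.\<close>

lemma dense_shadow_of_co_degree:
  assumes r: "r \<ge> 2" and G: "r_graph r V E"
    and deg: "real (min_pos_co_degree r V E)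
      \<ge> ((real r - 1) / real r) * real (card V) + (real r) ^ 2"
  shows "dense_shadow r V E"
proof
  show "r \<ge> 2" "finite V" "\<And>e. e \<in> E \<Longrightarrow> e \<subseteq> V" "\<And>e. e \<in> E \<Longrightarrow> card e = r"
    using r G by (auto simp: r_graph_def)
  fix S e
  assume S: "card S = r - 1" and e: "e \<in> E" "S \<subseteq> e"
  let ?N = "{z. insert z S \<in> E}"
  have finV: "finite V" and SV: "S \<subseteq> V" and NV: "?N \<subseteq> V"
    using G e by (auto simp: r_graph_def)
  have finE: "finite E"
    using G by (auto simp: r_graph_def intro!: finite_subset[of E "Pow V"])
  have "co_degree E S > 0"
    using e finE by (auto simp: co_degree_def card_gt_0_iff)
  then have "min_pos_co_degree r V E \<le> card ?N"
    using min_pos_co_degree_le[OF G SV S] co_degree_eq_card_neighbours[OF _ G S] r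
      finite_subset[OF SV finV] by simp
  with deg have "((real r - 1) / real r) * real (card V) + (real r) ^ 2 \<le> real (card ?N)"
    by linarith
  then have "real r * (((real r - 1) / real r) * real (card V) + (real r) ^ 2)
      \<le> real r * real (card ?N)"
    by (rule mult_left_mono) simp
  then have "(real r - 1) * real (card V) + real r ^ 3 \<le> real r * real (card ?N)"
    using r by (simp add: distrib_left power2_eq_square power3_eq_cube)
  moreover have "real (card V) = real (card (V - ?N)) + real (card ?N)"
    using finV NV card_Diff_subset[OF finite_subset[OF NV finV] NV] card_mono[OF finV NV]
    by simp
  ultimately have "real r * real (card (V - ?N)) + real r ^ 3 \<le> real (card V)"
    by (simp add: algebra_simps)
  then show "r * card (V - ?N) + r ^ 3 \<le> card V"
    by (metis of_nat_add of_nat_le_iff of_nat_mult of_nat_power)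
qed

theorem theorem1p11:
  fixes r n :: nat and V :: "'a set" and E :: "'a set set"
  assumes "r \<ge> 2"
    and "n \<ge> r ^ 3 + r ^ 2 - r"
    and "r dvd n"
    and "r_graph r V E"
    and "card V = n"
    and "real (min_pos_co_degree r V E) \<ge> ((real r - 1) / real r) * real n + (real r) ^ 2"
    and "\<And>v. v \<in> V \<Longrightarrow> vertex_degree E v > 0"
  shows "\<exists>M. perfect_matching V E M"
proof -
  interpret dense_shadow r V E
    using dense_shadow_of_co_degree assms by blast
  have "V \<subseteq> \<Union>E"
  proof
    fix v
    assume "v \<in> V"
    then have "{e \<in> E. v \<in> e} \<noteq> {}"
      using assms(7)[of v] unfolding vertex_degree_def by (metis card.empty less_irrefl)
    then show "v \<in> \<Union>E"
      by blast
  qed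
  then show ?thesis
    using perfect_matching_exists assms(3,5) by blast
qed

end
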